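(* Let $G$ be a countable amenable group acting on a compact metric space $(X,\rho)$. The function $X\ni x\mapsto h(x)=h_{\mathrm{top}}(\overline{Gx},G)\in[0,\infty)\cup\{\infty\}$ is lower semicontinuous with respect to $D_W$ and with respect to $D_W'$; that is, for $p\in\{D_W,D_W'\}$, whenever $x,x_n\in X$ satisfy $p(x_n,x)\to0$ as $n\to\infty$, one has $\liminf_{n\to\infty}h(x_n)\ge h(x)$.
   Context: $G$ is a discrete countable amenable group with identity $e$; $(X,\rho)$ is a compact metric space of diameter at most $1$; $G$ acts on $X$ via a continuous map $G\times X\to X$, $(g,x)\mapsto gx$, with $ex=x$ and $g(hx)=(gh)x$. $\overline{Gx}$ is the closure of the orbit $Gx=\{gx:g\in G\}$. $\mathrm{Fin}(G)$ is the family of non-empty finite subsets of $G$. A (left) Følner sequence is a sequence $\{F_n\}\subset\mathrm{Fin}(G)$ with $|gF_n\triangle F_n|/|F_n|\to0$ for every $g\in G$. Weyl pseudometric: for $x,z\in X$, $D_W(x,z)=\limsup_{n\to\infty}\frac1{|F_n|}\sup_{g\in G}\sum_{f\in F_ng}\rho(fx,fz)$ for a Følner sequence $\{F_n\}$ (the value does not depend on the Følner sequence). Upper Banach density of $A\subset G$: $D^*(A)=\inf_{F\in\mathrm{Fin}(G)}\sup_{g\in G}|A\cap Fg|/|F|$. For $x,z\in X$, $D_W'(x,z)=\inf\{\varepsilon>0: D^*(\{g\in G:\rho(gx,gz)>\varepsilon\})<\varepsilon\}$. Topological entropy: for a dynamical system $(Y,G)$ and an open cover $\mathcal U$ of $Y$,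 let $\mathcal N(\mathcal U)$ be the minimal cardinality of a subcover, and for $F\in\mathrm{Fin}(G)$ let $\mathcal U^F=\bigvee_{f\in F}f^{-1}\mathcal U$ (common refinement). Then $h(Y,G,\mathcal U)=\lim_n \log\mathcal N(\mathcal U^{F_n})/|F_n|$ (the limit exists and is independent of the Følner sequence) and $h_{\mathrm{top}}(Y,G)=\sup_{\mathcal U}h(Y,G,\mathcal U)$. *)

theory Defs
  imports "HOL-Analysis.Analysis" "HOL-Algebra.Group_Action"
begin

definition Fin :: "('g, 'm) monoid_scheme \<Rightarrow> 'g set set" where
  "Fin G = {F. F \<subseteq> carrier G \<and> finite F \<and> F \<noteq> {}}"

definition folner_seq :: "('g, 'm) monoid_scheme \<Rightarrow> (nat \<Rightarrow> 'g set) \<Rightarrow> bool" where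
  "folner_seq G F \<longleftrightarrow> (\<forall>n. F n \<in> Fin G) \<and>
     (\<forall>g\<in>carrier G. (\<lambda>n. real (card (sym_diff (g <#\<^bsub>G\<^esub> F n) (F n))) / real (card (F n))) \<longlonglongrightarrow> 0)"

text \<open>For countable discrete groups amenability is the existence of a left Folner sequence.\<close>

definition amenable :: "('g, 'm) monoid_scheme \<Rightarrow> bool" where
  "amenable G \<longleftrightarrow> (\<exists>F. folner_seq G F)"

text \<open>The continuity condition is that of the map from \<open>G \<times> X\<close> to \<open>X\<close>, as \<open>G\<close> is discrete.\<close>

definition continuous_action ::
  "('g, 'm) monoid_scheme \<Rightarrow> 'a::metric_space set \<Rightarrow> ('g \<Rightarrow> 'a \<Rightarrow> 'a) \<Rightarrow> bool" where
  "continuous_action G X \<phi> \<longleftrightarrow> group_action G X \<phi> \<and> (\<forall>g\<in>carrier G. continuous_on X (\<phi> g))"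

text \<open>The normalised sums lie between 0 and the diameter of \<open>X\<close>, so the extended-real limsup
  is finite and the conversion to a real number loses nothing.\<close>

definition weyl_dist ::
  "('g, 'm) monoid_scheme \<Rightarrow> ('g \<Rightarrow> 'a::metric_space \<Rightarrow> 'a) \<Rightarrow> (nat \<Rightarrow> 'g set) \<Rightarrow> 'a \<Rightarrow> 'a \<Rightarrow> real" where
  "weyl_dist G \<phi> F x z = real_of_ereal (limsup (\<lambda>n. ereal
     (1 / real (card (F n)) *
       (SUP g\<in>carrier G. \<Sum>f\<in>F n #>\<^bsub>G\<^esub> g. dist (\<phi> f x) (\<phi> f z)))))"

definition upper_banach_density :: "('g, 'm) monoid_scheme \<Rightarrow> 'g set \<Rightarrow> real" where
  "upper_banach_density G A =
     (INF F\<in>Fin G. SUP g\<in>carrier G. real (card (A \<inter> (F #>\<^bsub>G\<^esub> g))) / real (card F))"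

definition weyl_dist' ::
  "('g, 'm) monoid_scheme \<Rightarrow> ('g \<Rightarrow> 'a::metric_space \<Rightarrow> 'a) \<Rightarrow> 'a \<Rightarrow> 'a \<Rightarrow> real" where
  "weyl_dist' G \<phi> x z =
     Inf {\<epsilon>. \<epsilon> > 0 \<and>
       upper_banach_density G {g \<in> carrier G. dist (\<phi> g x) (\<phi> g z) > \<epsilon>} < \<epsilon>}"

definition open_covers :: "'a::topological_space set \<Rightarrow> 'a set set set" where
  "open_covers Y = {\<U>. (\<forall>U\<in>\<U>. openin (top_of_set Y) U) \<and> \<Union>\<U> = Y}"

definition cover_number :: "'a set \<Rightarrow> 'a set set \<Rightarrow> nat" where
  "cover_number Y \<U> = (LEAST k. \<exists>\<V>\<subseteq>\<U>. finite \<V> \<and> \<Union>\<V> = Y \<and> card \<V> = k)"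

text \<open>A member of the common refinement picks one member \<open>s f\<close> of \<open>\<U>\<close> for each \<open>f \<in> F\<close>
  and intersects the preimages of these under \<open>\<phi> f\<close>.\<close>

definition cover_refinement ::
  "('g \<Rightarrow> 'a \<Rightarrow> 'a) \<Rightarrow> 'a set \<Rightarrow> 'a set set \<Rightarrow> 'g set \<Rightarrow> 'a set set" where
  "cover_refinement \<phi> Y \<U> F = {\<Inter>f\<in>F. {y \<in> Y. \<phi> f y \<in> s f} | s. s \<in> F \<rightarrow> \<U>}"

text \<open>By the Ornstein-Weiss lemma the sequence below converges, for every Folner sequence and to
  a value independent of it; \<open>limsup\<close> is therefore its limit, chosen because it is total.\<close>

definition cover_entropy ::
  "('g \<Rightarrow> 'a \<Rightarrow> 'a) \<Rightarrow> (nat \<Rightarrow> 'g set) \<Rightarrow> 'a set \<Rightarrow> 'a set set \<Rightarrow> ereal" where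
  "cover_entropy \<phi> F Y \<U> =
     limsup (\<lambda>n. ereal (ln (real (cover_number Y (cover_refinement \<phi> Y \<U> (F n)))) / real (card (F n))))"

definition top_entropy ::
  "('g \<Rightarrow> 'a::topological_space \<Rightarrow> 'a) \<Rightarrow> (nat \<Rightarrow> 'g set) \<Rightarrow> 'a set \<Rightarrow> ereal" where
  "top_entropy \<phi> F Y = (SUP \<U>\<in>open_covers Y. cover_entropy \<phi> F Y \<U>)"

definition orbit_entropy ::
  "('g, 'm) monoid_scheme \<Rightarrow> ('g \<Rightarrow> 'a::topological_space \<Rightarrow> 'a) \<Rightarrow> (nat \<Rightarrow> 'g set) \<Rightarrow> 'a \<Rightarrow> ereal" where
  "orbit_entropy G \<phi> F x = top_entropy \<phi> F (closure (orbit G \<phi> x))"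

end

theory Submission
  imports Defs
begin

text \<open>
  Both pseudometrics express the same kind of closeness. If either of them is small at \<open>(z, x)\<close>, then
  for some small \<open>\<epsilon>\<close> there is a finite non-empty set \<open>K\<close> such that in every translate \<open>K g\<close> at most the
  fraction \<open>\<epsilon>\<close> of the elements \<open>h\<close> has \<open>dist (h z) (h x) > \<epsilon>\<close>: for the Weyl pseudometric by Markov's
  inequality, for the other one almost by definition
  (\<open>sparse_along_if_weyl_dist_less\<close>, \<open>sparse_along_if_weyl_dist'_less\<close>). Averaging over translates
  carries this uniform bound from the one set \<open>K\<close> to all far enough members of any Folner sequence
  (\<open>sparse_along_folner_seq\<close>). This is why the Folner sequence that defines the Weyl pseudometric and
  the one that defines entropy may be unrelated.

  It remains to see that the entropy of the orbit closure of \<open>x\<close> relative to a fixed cover \<open>\<U>\<close> exceeds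
  that of the orbit closure of \<open>z\<close> by little. Let \<open>H\<close> be a set of the Folner sequence. Along \<open>H\<close>, the
  points \<open>g x\<close> and \<open>g z\<close> have itineraries that are \<open>\<epsilon>\<close>-close except on a small fraction of \<open>H\<close>.
  So a cell of the orbit closure of \<open>z\<close> that contains \<open>g z\<close>, together with a record of the exceptional
  times and of the approximate position of \<open>g x\<close> at these times, determines a cell of \<open>\<U>\<^sup>H\<close> that
  contains \<open>g x\<close>. The number of possible records is at most \<open>exp (\<eta> * card H)\<close>, where \<open>\<eta>\<close> tends to \<open>0\<close>
  with \<open>\<epsilon>\<close> for fixed \<open>\<U>\<close> (\<open>card_sparse_words_le\<close>), whence
  \<open>cover_number_transfer\<close> and, in the limit, \<open>cover_entropy_transfer\<close>. Since entropy
  is the supremum over \<open>\<U>\<close>, lower semicontinuity follows by treating one cover \<open>\<U>\<close> at a time.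
\<close>

section \<open>Sparse subsets of a group\<close>

text \<open>With \<open>d\<close> fixed, the existence of such a finite non-empty \<open>K\<close> is a bound on the upper Banach
  density of \<open>A\<close>; keeping the witness \<open>K\<close> explicit is what allows it to be exchanged for a Folner set.\<close>

definition sparse_along ::
  "('g, 'm) monoid_scheme \<Rightarrow> 'g set \<Rightarrow> real \<Rightarrow> 'g set \<Rightarrow> bool" where
  "sparse_along G A d K \<longleftrightarrow>
     (\<forall>g\<in>carrier G. real (card (A \<inter> (K #>\<^bsub>G\<^esub> g))) \<le> d * real (card K))"

lemma (in group) bij_betw_r_coset:
  assumes "K \<subseteq> carrier G" "g \<in> carrier G"
  shows "bij_betw (\<lambda>k. k \<otimes> g) K (K #> g)"
  unfolding bij_betw_def r_coset_def
  using assms by (auto simp: inj_on_def subset_iff)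

lemma (in group) card_Int_r_coset:
  assumes "K \<subseteq> carrier G" "g \<in> carrier G"
  shows "card (A \<inter> (K #> g)) = card {k \<in> K. k \<otimes> g \<in> A}"
proof -
  have "A \<inter> (K #> g) = (\<lambda>k. k \<otimes> g) ` {k \<in> K. k \<otimes> g \<in> A}"
    by (auto simp: r_coset_def)
  moreover have "inj_on (\<lambda>k. k \<otimes> g) {k \<in> K. k \<otimes> g \<in> A}"
    using bij_betw_r_coset[OF assms] by (auto simp: bij_betw_def inj_on_def)
  ultimately show ?thesis
    by (simp add: card_image)
qed

lemma (in group) sparse_along_alt:
  assumes "K \<in> Fin G"
  shows "sparse_along G A d K \<longleftrightarrow>
    (\<forall>g\<in>carrier G. real (card {k \<in> K. k \<otimes> g \<in> A}) \<le> d * real (card K))"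
  using assms by (simp add: sparse_along_def Fin_def card_Int_r_coset)

text \<open>Replacing \<open>H\<close> by \<open>k H\<close> loses only elements of the symmetric difference. It is translation on
  the left that matters, because the factor \<open>g\<close> on the right ranges over the whole group.\<close>

lemma (in group) card_shift_le:
  assumes H: "H \<in> Fin G" and k: "k \<in> carrier G" and g: "g \<in> carrier G"
    and inv: "real (card (sym_diff (k <# H) H)) \<le> e * real (card H)"
  shows "real (card {h \<in> H. h \<otimes> g \<in> A})
    \<le> real (card {h \<in> H. k \<otimes> (h \<otimes> g) \<in> A}) + e * real (card H)"
proof -
  have fin: "finite H" and sub: "H \<subseteq> carrier G"
    using H by (auto simp: Fin_def)
  have fink: "finite (k <# H)"
    using fin by (simp add: l_coset_def)
  have "{h \<in> H. h \<otimes> g \<in> A}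
      \<subseteq> (\<lambda>h. k \<otimes> h) ` {h \<in> H. k \<otimes> (h \<otimes> g) \<in> A} \<union> sym_diff (k <# H) H"
  proof
    fix h assume h: "h \<in> {h \<in> H. h \<otimes> g \<in> A}"
    show "h \<in> (\<lambda>h. k \<otimes> h) ` {h \<in> H. k \<otimes> (h \<otimes> g) \<in> A} \<union> sym_diff (k <# H) H"
    proof (cases "h \<in> k <# H")
      case True
      then obtain h' where h': "h' \<in> H" "h = k \<otimes> h'"
        by (auto simp: l_coset_def)
      then have "k \<otimes> (h' \<otimes> g) \<in> A"
        using h k g sub by (auto simp: m_assoc subset_iff)
      then show ?thesis
        using h' by auto
    qed (use h in auto)
  qed
  then have "card {h \<in> H. h \<otimes> g \<in> A}
      \<le> card ((\<lambda>h. k \<otimes> h) ` {h \<in> H. k \<otimes> (h \<otimes> g) \<in> A} \<union> sym_diff (k <# H) H)"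
    by (intro card_mono) (use fin fink in auto)
  also have "\<dots> \<le> card ((\<lambda>h. k \<otimes> h) ` {h \<in> H. k \<otimes> (h \<otimes> g) \<in> A}) + card (sym_diff (k <# H) H)"
    by (rule card_Un_le)
  also have "\<dots> \<le> card {h \<in> H. k \<otimes> (h \<otimes> g) \<in> A} + card (sym_diff (k <# H) H)"
    using fin by (intro add_mono card_image_le) auto
  finally show ?thesis
    using inv by linarith
qed

lemma (in group) sparse_along_mono:
  assumes K: "K \<in> Fin G" and sparse: "sparse_along G A d K"
    and sub: "B \<subseteq> A" and le: "d \<le> d'"
  shows "sparse_along G B d' K"
  unfolding sparse_along_def
proof
  fix g assume g: "g \<in> carrier G"
  have "finite (K #> g)"
    using K by (simp add: Fin_def r_coset_def)
  then have "card (B \<inter> (K #> g)) \<le> card (A \<inter> (K #> g))"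
    using sub by (intro card_mono) auto
  then have "real (card (B \<inter> (K #> g))) \<le> d * real (card K)"
    using sparse g unfolding sparse_along_def by force
  also have "\<dots> \<le> d' * real (card K)"
    using le by (intro mult_right_mono) auto
  finally show "real (card (B \<inter> (K #> g))) \<le> d' * real (card K)" .
qed

text \<open>Count the pairs \<open>(k, h)\<close> with \<open>k h g \<in> A\<close> in two ways. Grouped by \<open>h\<close>, sparseness along
  \<open>K\<close> bounds each group; grouped by \<open>k\<close>, near-invariance of \<open>H\<close> makes every group almost as large
  as \<open>A \<inter> H g\<close>.\<close>

lemma (in group) sparse_along_almost_invariant:
  assumes K: "K \<in> Fin G" and H: "H \<in> Fin G"
    and sparse: "sparse_along G A d K"
    and inv: "\<And>k. k \<in> K \<Longrightarrow> real (card (sym_diff (k <# H) H)) \<le> e * real (card H)"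
  shows "sparse_along G A (d + e) H"
  unfolding sparse_along_alt[OF H]
proof
  fix g assume g: "g \<in> carrier G"
  have fin: "finite K" "finite H" and sub: "K \<subseteq> carrier G" "H \<subseteq> carrier G" and ne: "K \<noteq> {}"
    using K H by (auto simp: Fin_def)
  let ?a = "real (card {h \<in> H. h \<otimes> g \<in> A})"
  have "real (card K) * ?a = (\<Sum>k\<in>K. ?a)"
    by simp
  also have "\<dots> \<le> (\<Sum>k\<in>K. real (card {h \<in> H. k \<otimes> (h \<otimes> g) \<in> A}) + e * real (card H))"
    using sub by (intro sum_mono card_shift_le H g inv) auto
  also have "\<dots> = (\<Sum>k\<in>K. \<Sum>h\<in>H. of_bool (k \<otimes> (h \<otimes> g) \<in> A)) + real (card K) * (e * real (card H))"
    using fin by (simp add: sum.distrib of_bool_def sum.If_cases Int_def)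
  also have "(\<Sum>k\<in>K. \<Sum>h\<in>H. of_bool (k \<otimes> (h \<otimes> g) \<in> A))
      = (\<Sum>h\<in>H. real (card {k \<in> K. k \<otimes> (h \<otimes> g) \<in> A}))"
    using fin by (subst sum.swap) (simp add: of_bool_def sum.If_cases Int_def)
  also have "\<dots> \<le> (\<Sum>h\<in>H. d * real (card K))"
    using sparse g sub unfolding sparse_along_alt[OF K] by (intro sum_mono) auto
  finally have "real (card K) * ?a \<le> real (card K) * ((d + e) * real (card H))"
    by (simp add: algebra_simps)
  moreover have "0 < real (card K)"
    using fin ne by (simp add: card_gt_0_iff)
  ultimately show "?a \<le> (d + e) * real (card H)"
    by simp
qed

lemma (in group) sparse_along_folner_seq:
  assumes F: "folner_seq G F" and K: "K \<in> Fin G"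
    and sparse: "sparse_along G A d K" and e: "0 < e"
  shows "\<forall>\<^sub>F n in sequentially. sparse_along G A (d + e) (F n)"
proof -
  have "\<forall>\<^sub>F n in sequentially. \<forall>k\<in>K.
      real (card (sym_diff (k <# F n) (F n))) / real (card (F n)) < e"
  proof (intro eventually_ball_finite ballI)
    show "finite K"
      using K by (simp add: Fin_def)
    fix k assume "k \<in> K"
    then have "k \<in> carrier G"
      using K by (auto simp: Fin_def)
    then have "(\<lambda>n. real (card (sym_diff (k <# F n) (F n))) / real (card (F n))) \<longlonglongrightarrow> 0"
      using F by (auto simp: folner_seq_def)
    then show "\<forall>\<^sub>F n in sequentially. real (card (sym_diff (k <# F n) (F n))) / real (card (F n)) < e"
      by (rule order_tendstoD(2)) (rule e)
  qed
  then show ?thesis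
  proof eventually_elim
    case (elim n)
    have Fn: "F n \<in> Fin G"
      using F by (auto simp: folner_seq_def)
    then have "0 < real (card (F n))"
      by (auto simp: Fin_def card_gt_0_iff)
    with elim show ?case
      by (intro sparse_along_almost_invariant[OF K Fn sparse])
         (auto simp: divide_less_eq less_imp_le)
  qed
qed

section \<open>Sparse words\<close>

text \<open>Chernoff's bound: weight a word by \<open>exp (- a)\<close> for each letter that is not \<open>None\<close>. The total
  weight factorises into \<open>(1 + card P * exp (- a)) ^ n\<close>, where \<open>n = card F\<close>, while each of the words
  counted weighs at least \<open>exp (- a * d * n)\<close>. The number \<open>a\<close> is free; choosing it large
  and then \<open>d\<close> small makes the exponential growth rate as small as desired.\<close>

lemma card_sparse_words_le:
  fixes a d :: real
  assumes F: "finite F" and P: "finite P" and a: "0 \<le> a"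
  shows "real (card {w \<in> F \<rightarrow>\<^sub>E insert None (Some ` P).
            real (card {f \<in> F. w f \<noteq> None}) \<le> d * real (card F)})
    \<le> exp (real (card F) * (a * d + real (card P) * exp (- a)))"
    (is "real (card ?W) \<le> _")
proof -
  let ?L = "insert None (Some ` P)" and ?n = "real (card F)"
  let ?wt = "\<lambda>l. if l = None then 1 else exp (- a)"
  have finL: "finite ?L"
    using P by simp
  have finE: "finite (F \<rightarrow>\<^sub>E ?L)"
    using F finL by (intro finite_PiE) auto
  have sumL: "(\<Sum>l\<in>?L. ?wt l) = 1 + real (card P) * exp (- a)"
    using P by (simp add: image_iff sum.reindex)
  have "real (card ?W) * exp (- a * d * ?n) = (\<Sum>w\<in>?W. exp (- a * d * ?n))"
    by simp
  also have "\<dots> \<le> (\<Sum>w\<in>?W. \<Prod>f\<in>F. ?wt (w f))"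
  proof (rule sum_mono)
    fix w assume w: "w \<in> ?W"
    have "- a * d * ?n \<le> - a * real (card {f \<in> F. w f \<noteq> None})"
      using w mult_left_mono[OF _ a, of "real (card {f \<in> F. w f \<noteq> None})" "d * ?n"]
      by (simp add: mult.assoc)
    also have "exp (- a * real (card {f \<in> F. w f \<noteq> None})) = (\<Prod>f\<in>F. ?wt (w f))"
      using F by (simp add: prod.If_cases Int_def exp_of_nat_mult[symmetric] mult.commute)
    finally show "exp (- a * d * ?n) \<le> (\<Prod>f\<in>F. ?wt (w f))"
      by simp
  qed
  also have "\<dots> \<le> (\<Sum>w\<in>F \<rightarrow>\<^sub>E ?L. \<Prod>f\<in>F. ?wt (w f))"
    using finE by (intro sum_mono2) (auto intro!: prod_nonneg)
  also have "\<dots> = (\<Prod>f\<in>F. \<Sum>l\<in>?L. ?wt l)"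
    using F finL by (subst prod_sum_PiE) auto
  also have "\<dots> = (1 + real (card P) * exp (- a)) ^ card F"
    by (simp add: sumL)
  also have "\<dots> \<le> exp (real (card P) * exp (- a)) ^ card F"
    by (intro power_mono exp_ge_add_one_self) auto
  also have "\<dots> = exp (?n * (real (card P) * exp (- a)))"
    by (simp add: exp_of_nat_mult)
  finally have "real (card ?W) \<le> exp (?n * (real (card P) * exp (- a))) / exp (- a * d * ?n)"
    by (simp add: field_simps)
  also have "\<dots> = exp (?n * (a * d + real (card P) * exp (- a)))"
    by (simp add: exp_diff[symmetric] algebra_simps)
  finally show ?thesis .
qed

section \<open>Cover numbers\<close>

lemma cover_refinement_Union:
  assumes cov: "\<Union>\<U> = Y" and F: "F \<noteq> {}" and inv: "\<And>f y. f \<in> F \<Longrightarrow> y \<in> Y \<Longrightarrow> \<phi> f y \<in> Y"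
  shows "\<Union>(cover_refinement \<phi> Y \<U> F) = Y"
proof
  show "\<Union>(cover_refinement \<phi> Y \<U> F) \<subseteq> Y"
    using F by (auto simp: cover_refinement_def)
  show "Y \<subseteq> \<Union>(cover_refinement \<phi> Y \<U> F)"
  proof
    fix y assume y: "y \<in> Y"
    then have "\<forall>f\<in>F. \<exists>U\<in>\<U>. \<phi> f y \<in> U"
      using inv cov by blast
    then obtain s where "\<forall>f\<in>F. s f \<in> \<U> \<and> \<phi> f y \<in> s f"
      by metis
    then show "y \<in> \<Union>(cover_refinement \<phi> Y \<U> F)"
      using y by (auto simp: cover_refinement_def)
  qed
qed

lemma cover_refinement_openin:
  assumes F: "finite F" "F \<noteq> {}" and U: "\<And>U. U \<in> \<U> \<Longrightarrow> openin (top_of_set Y) U"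
    and inv: "\<And>f y. f \<in> F \<Longrightarrow> y \<in> Y \<Longrightarrow> \<phi> f y \<in> Y"
    and cont: "\<And>f. f \<in> F \<Longrightarrow> continuous_on Y (\<phi> f)"
    and W: "W \<in> cover_refinement \<phi> Y \<U> F"
  shows "openin (top_of_set Y) W"
proof -
  obtain s where s: "s \<in> F \<rightarrow> \<U>" and W: "W = (\<Inter>f\<in>F. {y \<in> Y. \<phi> f y \<in> s f})"
    using W by (auto simp: cover_refinement_def)
  have "openin (top_of_set Y) {y \<in> Y. \<phi> f y \<in> s f}" if "f \<in> F" for f
  proof -
    have "openin (top_of_set Y) (Y \<inter> \<phi> f -` s f)"
      using that s inv cont by (intro continuous_openin_preimage[where T = Y] U) auto
    also have "Y \<inter> \<phi> f -` s f = {y \<in> Y. \<phi> f y \<in> s f}"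
      by auto
    finally show ?thesis .
  qed
  then show ?thesis
    unfolding W using F by (intro openin_INT2) auto
qed

lemma cover_number_attained:
  assumes Y: "compact Y" and U: "\<And>U. U \<in> \<U> \<Longrightarrow> openin (top_of_set Y) U" and cov: "\<Union>\<U> = Y"
  obtains \<V> where "\<V> \<subseteq> \<U>" "finite \<V>" "\<Union>\<V> = Y" "card \<V> = cover_number Y \<U>"
proof -
  obtain \<D> where "\<D> \<subseteq> \<U>" "finite \<D>" "Y \<subseteq> \<Union>\<D>"
    using Y U cov unfolding compact_eq_openin_cover by (metis order_refl)
  then have "\<exists>k. \<exists>\<V>\<subseteq>\<U>. finite \<V> \<and> \<Union>\<V> = Y \<and> card \<V> = k"
    using cov by blast
  from LeastI_ex[OF this] show thesis
    using that unfolding cover_number_def by blast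
qed

lemma cover_number_pos:
  assumes "compact Y" "\<And>U. U \<in> \<U> \<Longrightarrow> openin (top_of_set Y) U" "\<Union>\<U> = Y" "Y \<noteq> {}"
  shows "0 < cover_number Y \<U>"
proof -
  obtain \<V> where "finite \<V>" "\<Union>\<V> = Y" "card \<V> = cover_number Y \<U>"
    using cover_number_attained[OF assms(1-3)] by metis
  then show ?thesis
    using assms(4) by (metis Union_empty card_gt_0_iff)
qed

text \<open>Replacing each non-empty \<open>T i\<close> by a member of \<open>\<U>\<close> above it gives a subcover, and the number of sets
  does not grow. Empty sets \<open>T i\<close> are exempt because itineraries below may be followed by no point.\<close>

lemma cover_number_le_card:
  assumes I: "finite I" and cov: "Y \<subseteq> (\<Union>i\<in>I. T i)" and sub: "\<And>U. U \<in> \<U> \<Longrightarrow> U \<subseteq> Y"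
    and fine: "\<And>i. i \<in> I \<Longrightarrow> T i \<noteq> {} \<Longrightarrow> \<exists>U\<in>\<U>. T i \<subseteq> U"
  shows "cover_number Y \<U> \<le> card I"
proof -
  let ?J = "{i \<in> I. T i \<noteq> {}}"
  obtain u where u: "\<And>i. i \<in> ?J \<Longrightarrow> u i \<in> \<U> \<and> T i \<subseteq> u i"
    using fine by (metis (mono_tags, lifting) mem_Collect_eq)
  have "\<Union>(u ` ?J) = Y"
  proof
    show "\<Union>(u ` ?J) \<subseteq> Y"
      using u sub by (intro UN_least) blast
    show "Y \<subseteq> \<Union>(u ` ?J)"
    proof
      fix y assume "y \<in> Y"
      then obtain i where "i \<in> I" "y \<in> T i"
        using cov by blast
      then show "y \<in> \<Union>(u ` ?J)"
        using u[of i] by blast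
    qed
  qed
  moreover have "u ` ?J \<subseteq> \<U>"
    using u by blast
  moreover have "finite (u ` ?J)"
    using I by simp
  ultimately have "\<exists>\<V>\<subseteq>\<U>. finite \<V> \<and> \<Union>\<V> = Y \<and> card \<V> = card (u ` ?J)"
    by blast
  then have "cover_number Y \<U> \<le> card (u ` ?J)"
    unfolding cover_number_def by (rule Least_le)
  also have "\<dots> \<le> card ?J"
    using I by (intro card_image_le) auto
  also have "\<dots> \<le> card I"
    using I by (intro card_mono) auto
  finally show ?thesis .
qed

lemma Lebesgue_number_openin:
  fixes Y :: "'a::metric_space set"
  assumes Y: "compact Y" and U: "\<U> \<in> open_covers Y"
  obtains \<delta> where "0 < \<delta>" "\<And>y. y \<in> Y \<Longrightarrow> \<exists>U\<in>\<U>. Y \<inter> ball y \<delta> \<subseteq> U"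
proof -
  let ?G = "{T. open T \<and> Y \<inter> T \<in> \<U>}"
  have "Y \<subseteq> \<Union>?G"
  proof
    fix y assume "y \<in> Y"
    then obtain U where "U \<in> \<U>" "y \<in> U"
      using U by (auto simp: open_covers_def)
    moreover from this obtain T where "open T" "U = Y \<inter> T"
      using U by (auto simp: open_covers_def openin_open)
    ultimately show "y \<in> \<Union>?G"
      by auto
  qed
  then obtain \<delta> where \<delta>: "0 < \<delta>" "\<And>y. y \<in> Y \<Longrightarrow> \<exists>T\<in>?G. ball y \<delta> \<subseteq> T"
    using Heine_Borel_lemma[OF Y, of ?G] by blast
  have "\<exists>U\<in>\<U>. Y \<inter> ball y \<delta> \<subseteq> U" if "y \<in> Y" for y
    using \<delta>(2)[OF that] by blast
  with \<delta>(1) show thesis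
    by (rule that)
qed

section \<open>Entropy of two orbits that are close most of the time\<close>

locale compact_action = group_action G X \<phi>
  for G :: "('g, 'm) monoid_scheme" (structure) and X :: "'a::metric_space set" and \<phi> +
  assumes compact_space: "compact X"
    and continuous_elements: "g \<in> carrier G \<Longrightarrow> continuous_on X (\<phi> g)"
begin

sublocale group G
  using group_hom by (rule group_hom.axioms(1))

abbreviation orbit_closure :: "'a \<Rightarrow> 'a set" where
  "orbit_closure x \<equiv> closure (orbit G \<phi> x)"

abbreviation deviation_set :: "real \<Rightarrow> 'a \<Rightarrow> 'a \<Rightarrow> 'g set" where
  "deviation_set \<epsilon> x z \<equiv> {g \<in> carrier G. \<epsilon> < dist (\<phi> g x) (\<phi> g z)}"

lemma action_closed: "g \<in> carrier G \<Longrightarrow> x \<in> X \<Longrightarrow> \<phi> g x \<in> X"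
  using element_image by blast

lemma orbit_closure_subset: "x \<in> X \<Longrightarrow> orbit_closure x \<subseteq> X"
  by (rule closure_minimal[OF _ compact_imp_closed[OF compact_space]])
    (auto simp: orbit_def action_closed)

lemma compact_orbit_closure: "x \<in> X \<Longrightarrow> compact (orbit_closure x)"
  using compact_Int_closed[OF compact_space closed_closure, of "orbit G \<phi> x"]
  by (simp add: Int_absorb1 orbit_closure_subset)

lemma continuous_on_orbit_closure:
  "g \<in> carrier G \<Longrightarrow> x \<in> X \<Longrightarrow> continuous_on (orbit_closure x) (\<phi> g)"
  by (rule continuous_on_subset[OF continuous_elements orbit_closure_subset])

lemma orbit_closure_nonempty: "orbit_closure x \<noteq> {}"
  by (simp add: orbit_def carrier_not_empty)

lemma orbit_closure_invariant:
  assumes g: "g \<in> carrier G" and x: "x \<in> X" and y: "y \<in> orbit_closure x"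
  shows "\<phi> g y \<in> orbit_closure x"
proof -
  have "\<phi> g ` orbit G \<phi> x \<subseteq> orbit_closure x"
  proof (clarsimp simp: orbit_def)
    fix h assume h: "h \<in> carrier G"
    have "\<phi> g (\<phi> h x) = \<phi> (g \<otimes> h) x"
      using composition_rule[OF x g h] by simp
    then have "\<phi> g (\<phi> h x) \<in> {\<phi> h x | h. h \<in> carrier G}"
      using g h by auto
    then show "\<phi> g (\<phi> h x) \<in> closure {\<phi> h x | h. h \<in> carrier G}"
      by (rule subsetD[OF closure_subset])
  qed
  then have "\<phi> g ` orbit_closure x \<subseteq> orbit_closure x"
    by (intro image_closure_subset continuous_on_orbit_closure g x) auto
  then show ?thesis
    using y by blast
qed

lemma open_cover_refinement:
  assumes x: "x \<in> X" and U: "\<U> \<in> open_covers (orbit_closure x)" and H: "H \<in> Fin G"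
  shows "\<Union>(cover_refinement \<phi> (orbit_closure x) \<U> H) = orbit_closure x"
    and "W \<in> cover_refinement \<phi> (orbit_closure x) \<U> H \<Longrightarrow> openin (top_of_set (orbit_closure x)) W"
proof -
  have H': "finite H" "H \<noteq> {}" "H \<subseteq> carrier G"
    using H by (auto simp: Fin_def)
  have inv: "\<And>f y. f \<in> H \<Longrightarrow> y \<in> orbit_closure x \<Longrightarrow> \<phi> f y \<in> orbit_closure x"
    using H' x orbit_closure_invariant by blast
  have cont: "\<And>f. f \<in> H \<Longrightarrow> continuous_on (orbit_closure x) (\<phi> f)"
    using H' x continuous_on_orbit_closure by blast
  show "\<Union>(cover_refinement \<phi> (orbit_closure x) \<U> H) = orbit_closure x"
    by (rule cover_refinement_Union) (use U H' inv in \<open>auto simp: open_covers_def\<close>)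
  show "openin (top_of_set (orbit_closure x)) W"
    if "W \<in> cover_refinement \<phi> (orbit_closure x) \<U> H"
    by (rule cover_refinement_openin[OF H'(1,2) _ inv cont that]) (use U in \<open>auto simp: open_covers_def\<close>)
qed

text \<open>Each cell \<open>S\<close> of an optimal subcover for \<open>z\<close> and each sparse word \<open>w\<close> over the net \<open>P\<close> prescribe
  an itinerary: at time \<open>f\<close> stay within \<open>r\<close> of the position \<open>q S f\<close> that \<open>S\<close> fixes up to \<open>r / 2\<close> if
  \<open>w f = None\<close>, and within \<open>r\<close> of the net point \<open>p\<close> if \<open>w f = Some p\<close>. The points that follow such an
  itinerary form a set \<open>T (S, w)\<close>. These sets cover the orbit of \<open>x\<close>; being closed and finite in
  number, they cover its closure, which a family of open sets covering the orbit need not do.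
  Two points of \<open>T (S, w)\<close> are within \<open>2 * r < 3 * r\<close> of each other at all times, so the Lebesgue
  number \<open>3 * r\<close> places \<open>T (S, w)\<close> inside one cell of the refinement of \<open>\<U>\<close>.\<close>

lemma cover_number_transfer:
  fixes r d a :: real
  assumes x: "x \<in> X" and z: "z \<in> X" and H: "H \<in> Fin G"
    and r: "0 < r" and Leb: "\<And>y. y \<in> orbit_closure x \<Longrightarrow> \<exists>U\<in>\<U>. orbit_closure x \<inter> ball y (3 * r) \<subseteq> U"
    and P: "finite P" "orbit_closure x \<subseteq> (\<Union>p\<in>P. cball p r)"
    and V: "\<V> \<in> open_covers (orbit_closure z)" and small: "\<And>V. V \<in> \<V> \<Longrightarrow> \<exists>q. V \<subseteq> ball q (r / 2)"
    and sparse: "sparse_along G (deviation_set (r / 2) z x) d H" and a: "0 \<le> a"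
  shows "real (cover_number (orbit_closure x) (cover_refinement \<phi> (orbit_closure x) \<U> H))
    \<le> real (cover_number (orbit_closure z) (cover_refinement \<phi> (orbit_closure z) \<V> H))
      * exp (real (card H) * (a * d + real (card P) * exp (- a)))"
proof -
  let ?Y = "orbit_closure x" and ?Z = "orbit_closure z"
  let ?W = "{w \<in> H \<rightarrow>\<^sub>E insert None (Some ` P). real (card {f \<in> H. w f \<noteq> None}) \<le> d * real (card H)}"
  have fin: "finite H" "H \<noteq> {}" and sub: "H \<subseteq> carrier G"
    using H by (auto simp: Fin_def)
  have finW: "finite ?W"
    using fin P by (intro finite_subset[OF _ finite_PiE[of H "\<lambda>_. insert None (Some ` P)"]]) auto
  obtain \<S> where \<S>: "\<S> \<subseteq> cover_refinement \<phi> ?Z \<V> H" "finite \<S>" "\<Union>\<S> = ?Z"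
      "card \<S> = cover_number ?Z (cover_refinement \<phi> ?Z \<V> H)"
    using cover_number_attained[OF compact_orbit_closure[OF z] open_cover_refinement(2)[OF z V H]
        open_cover_refinement(1)[OF z V H]] by metis
  have "\<exists>q. \<forall>f\<in>H. \<forall>y\<in>S. dist (q f) (\<phi> f y) < r / 2" if S: "S \<in> \<S>" for S
  proof -
    obtain s where s: "s \<in> H \<rightarrow> \<V>" "S = (\<Inter>f\<in>H. {y \<in> ?Z. \<phi> f y \<in> s f})"
      using subsetD[OF \<S>(1) S] by (auto simp: cover_refinement_def)
    then have "\<forall>f\<in>H. \<exists>q. s f \<subseteq> ball q (r / 2)"
      using small by blast
    then obtain q where "\<forall>f\<in>H. s f \<subseteq> ball (q f) (r / 2)"
      by metis
    then show ?thesis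
      using s(2) by (intro exI[of _ q]) (auto simp: subset_iff)
  qed
  then obtain q where q: "\<And>S f y. S \<in> \<S> \<Longrightarrow> f \<in> H \<Longrightarrow> y \<in> S \<Longrightarrow> dist (q S f) (\<phi> f y) < r / 2"
    by metis
  define c where "c S w f = (case w f of None \<Rightarrow> q S f | Some p \<Rightarrow> p)" for S and w :: "'g \<Rightarrow> 'a option" and f
  define T where "T i = {y \<in> ?Y. \<forall>f\<in>H. dist (c (fst i) (snd i) f) (\<phi> f y) \<le> r}" for i
  have closedT: "closed (T i)" for i
  proof -
    have "closed (?Y \<inter> \<phi> f -` cball (c (fst i) (snd i) f) r)" if "f \<in> H" for f
      using that sub x by (intro continuous_closed_preimage continuous_on_orbit_closure) auto
    then have "closed (\<Inter>f\<in>H. ?Y \<inter> \<phi> f -` cball (c (fst i) (snd i) f) r)"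
      by (intro closed_INT) blast
    moreover have "T i = (\<Inter>f\<in>H. ?Y \<inter> \<phi> f -` cball (c (fst i) (snd i) f) r)"
      using fin by (auto simp: T_def)
    ultimately show ?thesis
      by (simp only:)
  qed
  have orbit_covered: "orbit G \<phi> x \<subseteq> (\<Union>i\<in>\<S> \<times> ?W. T i)"
  proof
    fix y assume "y \<in> orbit G \<phi> x"
    then obtain g where g: "g \<in> carrier G" and y: "y = \<phi> g x"
      by (auto simp: orbit_def)
    have yY: "y \<in> ?Y"
      using \<open>y \<in> orbit G \<phi> x\<close> by (rule subsetD[OF closure_subset])
    have "\<phi> g z \<in> ?Z"
      by (rule subsetD[OF closure_subset]) (use g in \<open>auto simp: orbit_def\<close>)
    then obtain S where S: "S \<in> \<S>" "\<phi> g z \<in> S"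
      using \<S>(3) by blast
    have "\<forall>f\<in>H. \<exists>p\<in>P. dist p (\<phi> f y) \<le> r"
    proof
      fix f assume "f \<in> H"
      then have "\<phi> f y \<in> ?Y"
        using sub x yY orbit_closure_invariant by blast
      then show "\<exists>p\<in>P. dist p (\<phi> f y) \<le> r"
        using P(2) by (auto simp: subset_iff)
    qed
    then obtain p where p: "\<And>f. f \<in> H \<Longrightarrow> p f \<in> P \<and> dist (p f) (\<phi> f y) \<le> r"
      by metis
    \<comment> \<open>Record the position of \<open>f g x\<close> exactly at those times \<open>f\<close> at which it deviates from \<open>f g z\<close>.\<close>
    define w where "w = (\<lambda>f\<in>H. if f \<otimes> g \<in> deviation_set (r / 2) z x then Some (p f) else None)"
    have "{f \<in> H. w f \<noteq> None} = {f \<in> H. f \<otimes> g \<in> deviation_set (r / 2) z x}"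
      by (auto simp: w_def)
    then have "w \<in> ?W"
      using sparse g p unfolding sparse_along_alt[OF H] by (auto simp: w_def)
    moreover have "dist (c S w f) (\<phi> f y) \<le> r" if f: "f \<in> H" for f
    proof (cases "f \<otimes> g \<in> deviation_set (r / 2) z x")
      case True
      then show ?thesis
        using p f by (simp add: c_def w_def)
    next
      case False
      have fc: "f \<in> carrier G"
        using f sub by blast
      have "\<phi> (f \<otimes> g) z = \<phi> f (\<phi> g z)" "\<phi> (f \<otimes> g) x = \<phi> f y"
        using composition_rule[OF z fc g] composition_rule[OF x fc g] y by auto
      then have "dist (\<phi> f (\<phi> g z)) (\<phi> f y) \<le> r / 2"
        using False fc g by auto
      moreover have "dist (q S f) (\<phi> f (\<phi> g z)) < r / 2"
        using q[OF S(1) f S(2)] .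
      ultimately have "dist (q S f) (\<phi> f y) \<le> r"
        using dist_triangle[of "q S f" "\<phi> f y" "\<phi> f (\<phi> g z)"] by linarith
      moreover have "w f = None"
        using False f by (auto simp: w_def)
      ultimately show ?thesis
        by (simp add: c_def)
    qed
    ultimately have "(S, w) \<in> \<S> \<times> ?W" "y \<in> T (S, w)"
      using S(1) yY by (auto simp: T_def)
    then show "y \<in> (\<Union>i\<in>\<S> \<times> ?W. T i)"
      by blast
  qed
  have "cover_number ?Y (cover_refinement \<phi> ?Y \<U> H) \<le> card (\<S> \<times> ?W)"
  proof (rule cover_number_le_card)
    show finI: "finite (\<S> \<times> ?W)"
      using \<S>(2) finW by blast
    show "?Y \<subseteq> (\<Union>i\<in>\<S> \<times> ?W. T i)"
      by (rule closure_minimal[OF orbit_covered closed_UN[OF finI]]) (intro ballI closedT)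
    show "U \<subseteq> ?Y" if "U \<in> cover_refinement \<phi> ?Y \<U> H" for U
      using that fin by (auto simp: cover_refinement_def)
    fix i assume "T i \<noteq> {}"
    then obtain y0 where y0: "y0 \<in> ?Y" "\<And>f. f \<in> H \<Longrightarrow> dist (c (fst i) (snd i) f) (\<phi> f y0) \<le> r"
      by (auto simp: T_def)
    have "\<forall>f\<in>H. \<exists>U\<in>\<U>. ?Y \<inter> ball (\<phi> f y0) (3 * r) \<subseteq> U"
      using Leb orbit_closure_invariant[OF _ x y0(1)] sub by blast
    then obtain u where u: "\<And>f. f \<in> H \<Longrightarrow> u f \<in> \<U> \<and> ?Y \<inter> ball (\<phi> f y0) (3 * r) \<subseteq> u f"
      by metis
    have "T i \<subseteq> (\<Inter>f\<in>H. {y \<in> ?Y. \<phi> f y \<in> u f})"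
    proof (intro INT_greatest subsetI)
      fix f y assume f: "f \<in> H" and y: "y \<in> T i"
      have "dist (c (fst i) (snd i) f) (\<phi> f y) \<le> r"
        using y f by (simp add: T_def)
      then have "dist (\<phi> f y0) (\<phi> f y) < 3 * r"
        using y0(2)[OF f] r dist_triangle3[of "\<phi> f y0" "\<phi> f y" "c (fst i) (snd i) f"]
        by linarith
      moreover have "\<phi> f y \<in> ?Y"
        using y f sub x orbit_closure_invariant by (auto simp: T_def)
      ultimately show "y \<in> {y \<in> ?Y. \<phi> f y \<in> u f}"
        using u[OF f] y by (auto simp: T_def)
    qed
    then show "\<exists>U\<in>cover_refinement \<phi> ?Y \<U> H. T i \<subseteq> U"
      using u unfolding cover_refinement_def by blast
  qed
  then have "real (cover_number ?Y (cover_refinement \<phi> ?Y \<U> H)) \<le> real (card \<S>) * real (card ?W)"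
    by (simp only: card_cartesian_product of_nat_mult[symmetric] of_nat_le_iff)
  also have "\<dots> \<le> real (card \<S>) * exp (real (card H) * (a * d + real (card P) * exp (- a)))"
    using card_sparse_words_le[OF fin(1) P(1) a] by (intro mult_left_mono) auto
  finally show ?thesis
    by (simp add: \<S>(4))
qed

text \<open>The net \<open>P\<close> depends on \<open>x\<close> and \<open>\<U>\<close> alone, so \<open>\<epsilon>\<close> can be chosen before \<open>z\<close>. Only the cover
  of the orbit closure of \<open>z\<close> by small balls depends on \<open>z\<close>; its entropy is bounded by the full
  entropy of that orbit closure, whatever its size.\<close>

lemma cover_entropy_transfer:
  assumes F: "folner_seq G F" and x: "x \<in> X" and U: "\<U> \<in> open_covers (orbit_closure x)"
    and \<eta>: "0 < \<eta>"
  shows "\<exists>\<epsilon>>0. \<forall>z\<in>X. \<forall>K\<in>Fin G. sparse_along G (deviation_set \<epsilon> z x) \<epsilon> K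
      \<longrightarrow> cover_entropy \<phi> F (orbit_closure x) \<U> \<le> orbit_entropy G \<phi> F z + ereal \<eta>"
proof -
  let ?Y = "orbit_closure x"
  obtain \<delta> where \<delta>: "0 < \<delta>" "\<And>y. y \<in> ?Y \<Longrightarrow> \<exists>U\<in>\<U>. ?Y \<inter> ball y \<delta> \<subseteq> U"
    using Lebesgue_number_openin[OF compact_orbit_closure[OF x] U] by blast
  define r where "r = \<delta> / 3"
  have r: "0 < r" and Leb: "\<And>y. y \<in> ?Y \<Longrightarrow> \<exists>U\<in>\<U>. ?Y \<inter> ball y (3 * r) \<subseteq> U"
    using \<delta> by (auto simp: r_def)
  obtain P where P: "finite P" "?Y \<subseteq> (\<Union>p\<in>P. ball p r)"
    using seq_compact_imp_totally_bounded[OF compact_imp_seq_compact[OF compact_orbit_closure[OF x]]] r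
    by metis
  have Pc: "?Y \<subseteq> (\<Union>p\<in>P. cball p r)"
    using P(2) ball_subset_cball by blast
  \<comment> \<open>The records contribute the rate \<open>a * d + card P * exp (- a)\<close>. First \<open>a\<close> is taken so large that
    the second term is at most \<open>\<eta> / 2\<close>, then \<open>\<epsilon>\<close> so small that the first term is as well; there
    \<open>d = \<epsilon> + \<epsilon>\<close>, since passing to the Folner sequence costs a second \<open>\<epsilon>\<close>.\<close>
  define t where "t = 2 * (real (card P) + 1) / \<eta>"
  define a where "a = max 0 (ln t)"
  define \<epsilon> where "\<epsilon> = min (r / 2) (\<eta> / (4 * (a + 1)))"
  have t: "0 < t" and a: "0 \<le> a"
    using \<eta> by (auto simp: t_def a_def)
  have \<epsilon>: "0 < \<epsilon>" "\<epsilon> \<le> r / 2"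
    using r a \<eta> unfolding \<epsilon>_def by (simp, intro min.cobounded1)
  have "real (card P) * exp (- a) \<le> real (card P) * exp (- ln t)"
    by (intro mult_left_mono) (auto simp: a_def)
  also have "\<dots> = real (card P) / t"
    using t by (simp add: exp_minus divide_inverse)
  also have "\<dots> \<le> \<eta> / 2"
    using \<eta> by (simp add: t_def field_simps)
  finally have rate1: "real (card P) * exp (- a) \<le> \<eta> / 2" .
  have "a * (\<epsilon> + \<epsilon>) \<le> (a + 1) * (2 * (\<eta> / (4 * (a + 1))))"
    using a \<epsilon>(1) by (intro mult_mono) (auto simp: \<epsilon>_def)
  also have "\<dots> = \<eta> / 2"
    using a by (simp add: field_simps)
  finally have rate: "a * (\<epsilon> + \<epsilon>) + real (card P) * exp (- a) \<le> \<eta>"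
    using rate1 by linarith
  have "cover_entropy \<phi> F ?Y \<U> \<le> orbit_entropy G \<phi> F z + ereal \<eta>"
    if z: "z \<in> X" and K: "K \<in> Fin G" and sparse: "sparse_along G (deviation_set \<epsilon> z x) \<epsilon> K" for z K
  proof -
    let ?Z = "orbit_closure z"
    let ?M = "\<lambda>n. cover_number ?Y (cover_refinement \<phi> ?Y \<U> (F n))"
    define \<V> where "\<V> = (\<lambda>q. ?Z \<inter> ball q (r / 2)) ` ?Z"
    let ?N = "\<lambda>n. cover_number ?Z (cover_refinement \<phi> ?Z \<V> (F n))"
    have V: "\<V> \<in> open_covers ?Z"
      using r by (force simp: open_covers_def \<V>_def openin_open_Int)
    have small: "\<And>V. V \<in> \<V> \<Longrightarrow> \<exists>q. V \<subseteq> ball q (r / 2)"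
      by (auto simp: \<V>_def)
    have "\<forall>\<^sub>F n in sequentially. sparse_along G (deviation_set \<epsilon> z x) (\<epsilon> + \<epsilon>) (F n)"
      by (rule sparse_along_folner_seq[OF F K sparse \<epsilon>(1)])
    then have "\<forall>\<^sub>F n in sequentially.
        ereal (ln (real (?M n)) / real (card (F n))) \<le> ereal (ln (real (?N n)) / real (card (F n))) + ereal \<eta>"
    proof eventually_elim
      case (elim n)
      have Fn: "F n \<in> Fin G"
        using F by (auto simp: folner_seq_def)
      then have pos: "0 < real (card (F n))"
        by (auto simp: Fin_def card_gt_0_iff)
      have "sparse_along G (deviation_set (r / 2) z x) (\<epsilon> + \<epsilon>) (F n)"
        using \<epsilon>(2) by (intro sparse_along_mono[OF Fn elim]) auto
      note le = cover_number_transfer[OF x z Fn r Leb P(1) Pc V small this a]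
      have M: "0 < ?M n"
        using cover_number_pos[OF compact_orbit_closure[OF x] open_cover_refinement(2)[OF x U Fn]
          open_cover_refinement(1)[OF x U Fn] orbit_closure_nonempty] .
      have N: "0 < ?N n"
        using cover_number_pos[OF compact_orbit_closure[OF z] open_cover_refinement(2)[OF z V Fn]
          open_cover_refinement(1)[OF z V Fn] orbit_closure_nonempty] .
      have "ln (real (?M n))
          \<le> ln (real (?N n) * exp (real (card (F n)) * (a * (\<epsilon> + \<epsilon>) + real (card P) * exp (- a))))"
        using le M N by (subst ln_le_cancel_iff) auto
      also have "\<dots> = ln (real (?N n)) + real (card (F n)) * (a * (\<epsilon> + \<epsilon>) + real (card P) * exp (- a))"
        using N by (simp add: ln_mult)
      also have "\<dots> \<le> ln (real (?N n)) + real (card (F n)) * \<eta>"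
        using rate by (intro add_left_mono mult_left_mono) auto
      finally have "ln (real (?M n)) / real (card (F n)) \<le> ln (real (?N n)) / real (card (F n)) + \<eta>"
        using pos by (simp add: field_simps)
      then show ?case
        by simp
    qed
    then have "cover_entropy \<phi> F ?Y \<U>
        \<le> limsup (\<lambda>n. ereal (ln (real (?N n)) / real (card (F n))) + ereal \<eta>)"
      unfolding cover_entropy_def by (rule Limsup_mono)
    also have "\<dots> = cover_entropy \<phi> F ?Z \<V> + ereal \<eta>"
      unfolding cover_entropy_def by (rule Limsup_add_ereal_right) auto
    also have "\<dots> \<le> orbit_entropy G \<phi> F z + ereal \<eta>"
      unfolding orbit_entropy_def top_entropy_def by (intro add_right_mono SUP_upper V)
    finally show ?thesis .
  qed
  with \<epsilon>(1) show ?thesis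
    by blast
qed

section \<open>Smallness of the pseudometrics\<close>

lemma dist_action_le_1:
  assumes "diameter X \<le> 1" "x \<in> X" "y \<in> X" "f \<in> carrier G"
  shows "dist (\<phi> f x) (\<phi> f y) \<le> 1"
  using diameter_bounded_bound[OF compact_imp_bounded[OF compact_space] action_closed action_closed]
    assms by (meson order_trans)

text \<open>A value of the upper limit below \<open>\<epsilon>\<^sup>2\<close> gives one set \<open>E n\<close> all of whose translates have an average
  distance below \<open>\<epsilon>\<^sup>2\<close>. By Markov's inequality distances above \<open>\<epsilon>\<close> then occupy at most the fraction
  \<open>\<epsilon>\<close> of each translate.\<close>

lemma sparse_along_if_weyl_dist_less:
  assumes diam: "diameter X \<le> 1" and E: "folner_seq G E" and x: "x \<in> X" and z: "z \<in> X"
    and \<epsilon>: "0 < \<epsilon>" and less: "weyl_dist G \<phi> E z x < \<epsilon>\<^sup>2"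
  shows "\<exists>K\<in>Fin G. sparse_along G (deviation_set \<epsilon> z x) \<epsilon> K"
proof -
  let ?S = "\<lambda>n g. \<Sum>f\<in>E n #> g. dist (\<phi> f z) (\<phi> f x)"
  let ?b = "\<lambda>n. 1 / real (card (E n)) * (SUP g\<in>carrier G. ?S n g)"
  have En: "E n \<in> Fin G" for n
    using E by (auto simp: folner_seq_def)
  have pos: "0 < real (card (E n))" for n
    using En[of n] by (auto simp: Fin_def card_gt_0_iff)
  have sub: "E n #> g \<subseteq> carrier G" if "g \<in> carrier G" for n g
    using that En[of n] by (auto simp: r_coset_def Fin_def)
  note dist1 = dist_action_le_1[OF diam z x]
  have S_le: "?S n g \<le> real (card (E n))" if g: "g \<in> carrier G" for n g
  proof -
    have "?S n g \<le> (\<Sum>f\<in>E n #> g. 1)"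
      using sub[OF g] dist1 by (intro sum_mono) auto
    also have "\<dots> = real (card (E n))"
      using bij_betw_same_card[OF bij_betw_r_coset[OF _ g, of "E n"]] En[of n] by (simp add: Fin_def)
    finally show ?thesis .
  qed
  have bdd: "bdd_above (?S n ` carrier G)" for n
    using S_le by (intro bdd_aboveI2) auto
  have upper: "?S n g \<le> (SUP g\<in>carrier G. ?S n g)" if "g \<in> carrier G" for n g
    using that bdd by (rule cSUP_upper)
  have b0: "0 \<le> ?b n" for n
    using order_trans[OF sum_nonneg upper[OF one_closed]] by simp
  have b1: "?b n \<le> 1" for n
  proof -
    have "(SUP g\<in>carrier G. ?S n g) \<le> real (card (E n))"
      using S_le by (intro cSUP_least) auto
    then show ?thesis
      using pos[of n] by simp
  qed
  \<comment> \<open>The conversion from the extended reals sends \<open>\<infinity>\<close> to \<open>0\<close>, so a small value of \<open>weyl_dist\<close> says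
    something only because the upper limit is finite.\<close>
  let ?L = "limsup (\<lambda>n. ereal (?b n))"
  have "0 \<le> ?L"
    using b0 by (intro le_Limsup) (auto simp: zero_ereal_def)
  moreover have "?L \<le> 1"
    using b1 by (intro Limsup_bounded) (auto simp: one_ereal_def)
  ultimately have "?L = ereal (weyl_dist G \<phi> E z x)"
    unfolding weyl_dist_def by (intro ereal_real'[symmetric]) auto
  then have "?L < ereal (\<epsilon>\<^sup>2)"
    using less by simp
  then have "\<forall>\<^sub>F n in sequentially. ereal (?b n) < ereal (\<epsilon>\<^sup>2)"
    by (rule Limsup_lessD)
  then obtain n where "ereal (?b n) < ereal (\<epsilon>\<^sup>2)"
    by (auto simp: eventually_sequentially)
  then have sup_less: "(SUP g\<in>carrier G. ?S n g) < \<epsilon>\<^sup>2 * real (card (E n))"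
    using pos[of n] by (simp add: field_simps)
  have "sparse_along G (deviation_set \<epsilon> z x) \<epsilon> (E n)"
    unfolding sparse_along_def
  proof
    fix g assume g: "g \<in> carrier G"
    let ?A = "deviation_set \<epsilon> z x \<inter> (E n #> g)"
    have fin: "finite (E n #> g)"
      using En[of n] by (simp add: Fin_def r_coset_def)
    have "real (card ?A) * \<epsilon> = (\<Sum>f\<in>?A. \<epsilon>)"
      by simp
    also have "\<dots> \<le> (\<Sum>f\<in>?A. dist (\<phi> f z) (\<phi> f x))"
      by (intro sum_mono) auto
    also have "\<dots> \<le> ?S n g"
      using fin by (intro sum_mono2) auto
    also have "\<dots> \<le> \<epsilon>\<^sup>2 * real (card (E n))"
      using upper[OF g, of n] sup_less by linarith
    finally have "\<epsilon> * real (card ?A) \<le> \<epsilon> * (\<epsilon> * real (card (E n)))"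
      by (simp add: power2_eq_square algebra_simps)
    then show "real (card ?A) \<le> \<epsilon> * real (card (E n))"
      using \<epsilon> by simp
  qed
  then show ?thesis
    using En by blast
qed

lemma sparse_along_if_upper_banach_density_less:
  assumes "upper_banach_density G A < d"
  shows "\<exists>K\<in>Fin G. sparse_along G A d K"
proof -
  let ?r = "\<lambda>K g. real (card (A \<inter> (K #> g))) / real (card K)"
  have "{\<one>} \<in> Fin G"
    by (simp add: Fin_def)
  then obtain K where K: "K \<in> Fin G" "(SUP g\<in>carrier G. ?r K g) < d"
    using assms cInf_lessD[of "(\<lambda>K. SUP g\<in>carrier G. ?r K g) ` Fin G" d]
    unfolding upper_banach_density_def by blast
  have pos: "0 < real (card K)"
    using K by (auto simp: Fin_def card_gt_0_iff)
  have le1: "?r K g \<le> 1" if g: "g \<in> carrier G" for g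
  proof -
    have "card (A \<inter> (K #> g)) \<le> card (K #> g)"
      using K by (intro card_mono) (auto simp: Fin_def r_coset_def)
    also have "\<dots> = card K"
      using bij_betw_same_card[OF bij_betw_r_coset[OF _ g, of K]] K by (simp add: Fin_def)
    finally show ?thesis
      using pos by simp
  qed
  have "bdd_above (?r K ` carrier G)"
    using le1 by (intro bdd_aboveI2) auto
  then have "?r K g < d" if g: "g \<in> carrier G" for g
    using le_less_trans[OF cSUP_upper[OF g] K(2)] by simp
  then have "sparse_along G A d K"
    using pos by (auto simp: sparse_along_def divide_less_eq less_imp_le)
  with K(1) show ?thesis
    by blast
qed

text \<open>The infimum need not be attained; a smaller admissible \<open>e\<close> serves as well, since the deviation
  sets shrink as \<open>\<epsilon>\<close> grows.\<close>

lemma sparse_along_if_weyl_dist'_less: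
  assumes diam: "diameter X \<le> 1" and x: "x \<in> X" and z: "z \<in> X" and less: "weyl_dist' G \<phi> z x < \<epsilon>"
  shows "\<exists>K\<in>Fin G. sparse_along G (deviation_set \<epsilon> z x) \<epsilon> K"
proof -
  let ?D = "{\<epsilon>. \<epsilon> > 0 \<and> upper_banach_density G (deviation_set \<epsilon> z x) < \<epsilon>}"
  note dist1 = dist_action_le_1[OF diam z x]
  \<comment> \<open>An infimum of reals below \<open>\<epsilon>\<close> yields a witness only if the set is non-empty; \<open>2\<close> exceeds all
    distances in \<open>X\<close>.\<close>
  have empty: "deviation_set 2 z x = {}"
    using dist1 by force
  have "{\<one>} \<in> Fin G"
    by (simp add: Fin_def)
  then have "Fin G \<noteq> {}"
    by blast
  then have "upper_banach_density G (deviation_set 2 z x) < 2"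
    unfolding empty upper_banach_density_def by (simp add: carrier_not_empty)
  then have "2 \<in> ?D"
    by simp
  then obtain e where e: "upper_banach_density G (deviation_set e z x) < e" "e < \<epsilon>"
    using less cInf_lessD[of ?D \<epsilon>] unfolding weyl_dist'_def by blast
  obtain K where K: "K \<in> Fin G" "sparse_along G (deviation_set e z x) e K"
    using sparse_along_if_upper_banach_density_less[OF e(1)] by blast
  have "sparse_along G (deviation_set \<epsilon> z x) \<epsilon> K"
    using e(2) by (intro sparse_along_mono[OF K]) auto
  with K(1) show ?thesis
    by blast
qed

section \<open>Lower semicontinuity\<close>

lemma orbit_entropy_lower_semicontinuous:
  assumes F: "folner_seq G F" and x: "x \<in> X" and xs: "\<And>n. xs n \<in> X"
    and sparse: "\<And>\<epsilon>. 0 < \<epsilon> \<Longrightarrow>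
      \<forall>\<^sub>F n in sequentially. \<exists>K\<in>Fin G. sparse_along G (deviation_set \<epsilon> (xs n) x) \<epsilon> K"
  shows "orbit_entropy G \<phi> F x \<le> liminf (\<lambda>n. orbit_entropy G \<phi> F (xs n))"
  unfolding le_Liminf_iff
proof (intro allI impI)
  fix y assume "y < orbit_entropy G \<phi> F x"
  then obtain \<U> where U: "\<U> \<in> open_covers (orbit_closure x)" "y < cover_entropy \<phi> F (orbit_closure x) \<U>"
    unfolding orbit_entropy_def top_entropy_def less_SUP_iff by blast
  obtain a where a: "y < ereal a" "ereal a < cover_entropy \<phi> F (orbit_closure x) \<U>"
    using ereal_dense2[OF U(2)] by blast
  obtain b where b: "ereal a < ereal b" "ereal b < cover_entropy \<phi> F (orbit_closure x) \<U>"
    using ereal_dense2[OF a(2)] by blast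
  have pos: "0 < b - a"
    using b by simp
  obtain \<epsilon> where \<epsilon>: "0 < \<epsilon>" "\<forall>z\<in>X. \<forall>K\<in>Fin G. sparse_along G (deviation_set \<epsilon> z x) \<epsilon> K
      \<longrightarrow> cover_entropy \<phi> F (orbit_closure x) \<U> \<le> orbit_entropy G \<phi> F z + ereal (b - a)"
    using cover_entropy_transfer[OF F x U(1) pos] by blast
  show "\<forall>\<^sub>F n in sequentially. y < orbit_entropy G \<phi> F (xs n)"
    using sparse[OF \<epsilon>(1)]
  proof eventually_elim
    case (elim n)
    then have "cover_entropy \<phi> F (orbit_closure x) \<U> \<le> orbit_entropy G \<phi> F (xs n) + ereal (b - a)"
      using \<epsilon>(2) xs by blast
    with b(2) have "ereal b < orbit_entropy G \<phi> F (xs n) + ereal (b - a)"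
      by (rule less_le_trans)
    then have "ereal a < orbit_entropy G \<phi> F (xs n)"
      by (cases "orbit_entropy G \<phi> F (xs n)") auto
    with a(1) show ?case
      by (rule less_trans)
  qed
qed

end

theorem theorem29:
  fixes G :: "('g, 'm) monoid_scheme"
    and X :: "'a::metric_space set"
    and \<phi> :: "'g \<Rightarrow> 'a \<Rightarrow> 'a"
    and E F :: "nat \<Rightarrow> 'g set"
  assumes "group G" and "countable (carrier G)" and "amenable G"
    and "compact X" and "diameter X \<le> 1"
    and "continuous_action G X \<phi>"
    and "folner_seq G E" and "folner_seq G F"
  shows "\<forall>p \<in> {weyl_dist G \<phi> E, weyl_dist' G \<phi>}.
           \<forall>x xs. x \<in> X \<longrightarrow> (\<forall>n. xs n \<in> X) \<longrightarrow> (\<lambda>n. p (xs n) x) \<longlonglongrightarrow> 0 \<longrightarrow>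
             liminf (\<lambda>n. orbit_entropy G \<phi> F (xs n)) \<ge> orbit_entropy G \<phi> F x"
proof (intro ballI allI impI)
  fix p x xs
  assume p: "p \<in> {weyl_dist G \<phi> E, weyl_dist' G \<phi>}" and x: "x \<in> X" and "\<forall>n. xs n \<in> X"
    and lim: "(\<lambda>n. p (xs n) x) \<longlonglongrightarrow> 0"
  interpret compact_action G X \<phi>
    using assms by (auto simp: compact_action_def compact_action_axioms_def continuous_action_def)
  have xs: "\<And>n. xs n \<in> X"
    using \<open>\<forall>n. xs n \<in> X\<close> by blast
  show "orbit_entropy G \<phi> F x \<le> liminf (\<lambda>n. orbit_entropy G \<phi> F (xs n))"
  proof (rule orbit_entropy_lower_semicontinuous[OF \<open>folner_seq G F\<close> x xs])
    fix \<epsilon> :: real assume \<epsilon>: "0 < \<epsilon>"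
    have ev: "\<forall>\<^sub>F n in sequentially. p (xs n) x < \<epsilon>" "\<forall>\<^sub>F n in sequentially. p (xs n) x < \<epsilon>\<^sup>2"
      using \<epsilon> by (auto intro!: order_tendstoD(2)[OF lim])
    show "\<forall>\<^sub>F n in sequentially. \<exists>K\<in>Fin G. sparse_along G (deviation_set \<epsilon> (xs n) x) \<epsilon> K"
    proof (cases "p = weyl_dist G \<phi> E")
      case True
      show ?thesis
        using ev(2) by (rule eventually_mono)
          (use True sparse_along_if_weyl_dist_less[OF \<open>diameter X \<le> 1\<close> \<open>folner_seq G E\<close> x xs \<epsilon>] in blast)
    next
      case False
      show ?thesis
        using ev(1) by (rule eventually_mono)
          (use False p sparse_along_if_weyl_dist'_less[OF \<open>diameter X \<le> 1\<close> x xs] in blast)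
    qed
  qed
qed

end
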